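(* Let $E$ be an atomic Banach lattice, let $F$ be a Banach lattice, and let $T:E\to F$ be a nonzero linear operator whose modulus $|T|$ exists. Then the carrier $C_T$ is generated by finitely many atoms of $E$ if one of the following conditions is satisfied: (1) $Tx_\alpha\to 0$ for every disjoint net $(x_\alpha)\subset E$; (2) $Tx_\alpha\to 0$ for every $uo$-null net $(x_\alpha)\subset E$; (3) $E$ has order continuous norm and $Tx_\alpha\to 0$ for every $un$-null net $(x_\alpha)\subset E$; (4) $Tx_\alpha\to 0$ for every $uaw$-null net $(x_\alpha)\subset E$; (5) $E$ is a dual Banach lattice and $Tx_\alpha\to 0$ for every $uaw^*$-null net $(x_\alpha)\subset E$.
   Context: The convergence $Tx_\alpha\to0$ is norm convergence in $F$. Modulus and carrier: linear operators $E\to F$ are ordered by $S\ge T$ iff $(S-T)x\ge 0$ for all $x\in E_+$; the modulus of $T$ exists if $|T|:=T\vee(-T)$ exists in this order. The carrier of $T$ is $C_T:=\{x\in E: |T|(|x|)=0\}^d$, where $A^d$ is the disjoint complement of $A$. Atoms: $e>0$ in $E$ is an atom if for all $u,v\in[0,e]$ with $u\wedge v=0$, either $u=0$ or $v=0$. The band generated by an atom $e$ is $\mathrm{span}\{e\}$, and the span of a finite set of atoms is a projection band. $E$ is atomic if the band generated by all atoms of $E$ is $E$. Disjoint nets: a net $(x_\alpha)$ is disjoint if $|x_\alpha|\wedge|x_\beta|=0$ whenever $\alpha\neq\beta$. Order convergence: a net $(x_\alpha)$ in a Riesz space is order convergent to $x$ if there is a net $(y_\beta)$, possibly over a different index set,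 with $y_\beta\downarrow 0$ such that for each $\beta$ there is $\alpha_0$ with $|x_\alpha-x|\le y_\beta$ for all $\alpha\ge\alpha_0$. Unbounded convergences: a net $(x_\alpha)$ in a Banach lattice $E$ is $uo$-null (resp. $un$-null, $uaw$-null) if for every $u\in E_+$ the net $(|x_\alpha|\wedge u)$ converges to $0$ in order (resp. in norm, weakly). If $E=G'$ is the dual of a Banach lattice $G$ (a dual Banach lattice), a net $(x_\alpha)$ in $E$ is $uaw^*$-null if $|x_\alpha|\wedge u\to 0$ in the weak* topology $\sigma(G',G)$ for every $u\in E_+$. *)

theory Defs
  imports "HOL-Analysis.Analysis" "HOL-Library.Lattice_Algebras" "HOL-Library.Lub_Glb"
begin

section \<open>Banach lattices\<close>

class banach_lattice = banach + ordered_real_vector + lattice_ab_group_add_abs +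
  assumes norm_abs_mono: "\<bar>x\<bar> \<le> \<bar>y\<bar> \<Longrightarrow> norm x \<le> norm y"

instance real :: banach_lattice
  by standard auto

definition disj_compl :: "'e::banach_lattice set \<Rightarrow> 'e set" where
  "disj_compl A = {x. \<forall>y\<in>A. inf \<bar>x\<bar> \<bar>y\<bar> = 0}"

definition band :: "'e::banach_lattice set \<Rightarrow> bool" where
  "band B \<longleftrightarrow> subspace B \<and> (\<forall>x y. y \<in> B \<and> \<bar>x\<bar> \<le> \<bar>y\<bar> \<longrightarrow> x \<in> B) \<and>
     (\<forall>D s. D \<subseteq> B \<and> D \<noteq> {} \<and> isLub UNIV D s \<longrightarrow> s \<in> B)"

definition atom :: "'e::banach_lattice \<Rightarrow> bool" where
  "atom e \<longleftrightarrow> 0 < e \<and> (\<forall>u\<in>{0..e}. \<forall>v\<in>{0..e}. inf u v = 0 \<longrightarrow> u = 0 \<or> v = 0)"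

text \<open>The band generated by a set \<open>A\<close> is \<open>band hull A\<close>.\<close>

definition atomic_lattice :: "'e::banach_lattice itself \<Rightarrow> bool" where
  "atomic_lattice _ \<longleftrightarrow> band hull {e::'e. atom e} = UNIV"


section \<open>Modulus and carrier of a linear operator\<close>

definition op_le :: "('e::banach_lattice \<Rightarrow> 'f::banach_lattice) \<Rightarrow> ('e \<Rightarrow> 'f) \<Rightarrow> bool" where
  "op_le T S \<longleftrightarrow> (\<forall>x\<ge>0. 0 \<le> S x - T x)"

definition is_modulus :: "('e::banach_lattice \<Rightarrow> 'f::banach_lattice) \<Rightarrow> ('e \<Rightarrow> 'f) \<Rightarrow> bool" where
  "is_modulus T M \<longleftrightarrow> linear M \<and> op_le T M \<and> op_le (\<lambda>x. - T x) M \<and>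
     (\<forall>S. linear S \<and> op_le T S \<and> op_le (\<lambda>x. - T x) S \<longrightarrow> op_le M S)"

definition has_modulus :: "('e::banach_lattice \<Rightarrow> 'f::banach_lattice) \<Rightarrow> bool" where
  "has_modulus T \<longleftrightarrow> (\<exists>M. is_modulus T M)"

definition op_modulus :: "('e::banach_lattice \<Rightarrow> 'f::banach_lattice) \<Rightarrow> 'e \<Rightarrow> 'f" where
  "op_modulus T = (THE M. is_modulus T M)"

lemma op_modulus_eq:
  fixes T :: "'e::banach_lattice \<Rightarrow> 'f::banach_lattice"
  assumes "is_modulus T M"
  shows "op_modulus T = M"
  unfolding op_modulus_def
proof (rule the_equality, rule assms)
  fix N assume N: "is_modulus T N"
  have lin: "linear M" "linear N"
    using assms N by (auto simp: is_modulus_def)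
  have pos: "M x = N x" if "x \<ge> 0" for x
    using assms N that by (auto simp: is_modulus_def op_le_def intro: antisym)
  show "N = M"
  proof
    fix x :: 'e
    have "x = (sup x 0) - (sup (-x) 0)"
      using prts[of x] by (simp add: pprt_def nprt_def neg_inf_eq_sup)
    then show "N x = M x"
      using pos[of "sup x 0"] pos[of "sup (-x) 0"] lin by (metis linear_diff sup_ge2)
  qed
qed

definition carrier_of :: "('e::banach_lattice \<Rightarrow> 'f::banach_lattice) \<Rightarrow> 'e set" where
  "carrier_of T = disj_compl {x. op_modulus T \<bar>x\<bar> = 0}"


section \<open>Nets\<close>

text \<open>
  A net is given by an index set \<open>I\<close>, a relation \<open>r\<close> directing it (where \<open>(i, j) \<in> r\<close> means
  \<open>i \<le> j\<close>), and a function \<open>x\<close>, of which only the values on \<open>I\<close> matter. Its convergence is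
  convergence along \<open>tails I r\<close>.
\<close>

definition directed_set :: "'i set \<Rightarrow> 'i rel \<Rightarrow> bool" where
  "directed_set I r \<longleftrightarrow> I \<noteq> {} \<and> preorder_on I r \<and> (\<forall>i\<in>I. \<forall>j\<in>I. \<exists>k\<in>I. (i, k) \<in> r \<and> (j, k) \<in> r)"

definition tails :: "'i set \<Rightarrow> 'i rel \<Rightarrow> 'i filter" where
  "tails I r = (INF i\<in>I. principal {j\<in>I. (i, j) \<in> r})"

lemma eventually_tails:
  assumes "directed_set I r"
  shows "eventually P (tails I r) \<longleftrightarrow> (\<exists>i\<in>I. \<forall>j\<in>I. (i, j) \<in> r \<longrightarrow> P j)"
proof -
  have "trans r" "I \<noteq> {}" and dir: "\<forall>i\<in>I. \<forall>j\<in>I. \<exists>k\<in>I. (i, k) \<in> r \<and> (j, k) \<in> r"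
    using assms by (auto simp: directed_set_def preorder_on_def)
  have "\<exists>k\<in>I. principal {j\<in>I. (k, j) \<in> r}
      \<le> inf (principal {j\<in>I. (a, j) \<in> r}) (principal {j\<in>I. (b, j) \<in> r})"
    if ab: "a \<in> I" "b \<in> I" for a b
  proof -
    obtain k where "k \<in> I" "(a, k) \<in> r" "(b, k) \<in> r" using dir ab by blast
    then show ?thesis
      using \<open>trans r\<close> by (intro bexI[of _ k]) (auto dest: transD)
  qed
  then show ?thesis
    unfolding tails_def using \<open>I \<noteq> {}\<close>
    by (subst eventually_INF_base) (auto simp: eventually_principal)
qed

text \<open>
  HOL cannot quantify over all index types inside a formula. Quantifiers over nets in \<open>'e\<close>
  therefore range over the following index type, which is large enough: see
  \<open>net_reindex\<close>, \<open>order_convI\<close> and \<open>disjoint_net_reindex\<close> below.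
\<close>

type_synonym 'e idx = "'e \<times> 'e set"

lemma net_reindex:
  fixes x :: "'i \<Rightarrow> 'e"
  assumes "directed_set I r"
  shows "\<exists>(J :: 'e idx set) s y. directed_set J s \<and> filtermap y (tails J s) = filtermap x (tails I r)"
proof -
  define tl where "tl i = x ` {j\<in>I. (i, j) \<in> r}" for i
  define J where "J = {(a, S). a \<in> S \<and> S \<in> tl ` I}"
  define s where "s = {(p, q). p \<in> J \<and> q \<in> J \<and> snd q \<subseteq> snd p}"
  have r: "trans r" "I \<noteq> {}" "refl_on I r" "\<forall>i\<in>I. \<forall>j\<in>I. \<exists>k\<in>I. (i, k) \<in> r \<and> (j, k) \<in> r"
    using assms by (auto simp: directed_set_def preorder_on_def)
  have tl: "(x i, tl i) \<in> J" if "i \<in> I" for i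
    using that r by (auto simp: J_def tl_def refl_on_def)
  have tl_mono: "tl j \<subseteq> tl i" if "(i, j) \<in> r" for i j
    using that r by (auto simp: tl_def dest: transD)
  have dir: "directed_set J s"
    unfolding directed_set_def
  proof (intro conjI ballI)
    show "J \<noteq> {}" using tl r by blast
    show "preorder_on J s"
      by (auto simp: preorder_on_def refl_on_def trans_def s_def)
    fix p q assume pq: "p \<in> J" "q \<in> J"
    then obtain i j where ij: "i \<in> I" "j \<in> I" "snd p = tl i" "snd q = tl j"
      by (auto simp: J_def)
    then obtain k where k: "k \<in> I" "(i, k) \<in> r" "(j, k) \<in> r" using r by blast
    show "\<exists>k\<in>J. (p, k) \<in> s \<and> (q, k) \<in> s"
      using tl[OF k(1)] tl_mono[OF k(2)] tl_mono[OF k(3)] ij pq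
      by (intro bexI[of _ "(x k, tl k)"]) (auto simp: s_def)
  qed
  have "eventually P (filtermap fst (tails J s)) \<longleftrightarrow> eventually P (filtermap x (tails I r))" for P
  proof -
    have "eventually P (filtermap fst (tails J s)) \<longleftrightarrow> (\<exists>p\<in>J. \<forall>q\<in>J. (p, q) \<in> s \<longrightarrow> P (fst q))"
      by (simp add: eventually_filtermap eventually_tails[OF dir])
    also have "\<dots> \<longleftrightarrow> (\<exists>i\<in>I. \<forall>a\<in>tl i. P a)"
    proof
      assume "\<exists>p\<in>J. \<forall>q\<in>J. (p, q) \<in> s \<longrightarrow> P (fst q)"
      then obtain p where p: "p \<in> J" "\<forall>q\<in>J. (p, q) \<in> s \<longrightarrow> P (fst q)" by blast
      then obtain i where i: "i \<in> I" "snd p = tl i" by (auto simp: J_def)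
      have "P a" if "a \<in> tl i" for a
      proof -
        have "(a, tl i) \<in> J" using that i by (auto simp: J_def)
        moreover from this have "(p, (a, tl i)) \<in> s" using p i by (auto simp: s_def)
        ultimately show ?thesis using p(2) by force
      qed
      with i show "\<exists>i\<in>I. \<forall>a\<in>tl i. P a" by blast
    next
      assume "\<exists>i\<in>I. \<forall>a\<in>tl i. P a"
      then obtain i where i: "i \<in> I" "\<forall>a\<in>tl i. P a" by blast
      show "\<exists>p\<in>J. \<forall>q\<in>J. (p, q) \<in> s \<longrightarrow> P (fst q)"
        using i tl[OF i(1)] by (intro bexI[of _ "(x i, tl i)"]) (auto simp: s_def J_def)
    qed
    also have "\<dots> \<longleftrightarrow> eventually P (filtermap x (tails I r))"
      by (auto simp: eventually_filtermap eventually_tails[OF assms] tl_def)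
    finally show ?thesis .
  qed
  then have "filtermap fst (tails J s) = filtermap x (tails I r)"
    by (simp add: filter_eq_iff)
  with dir show ?thesis by blast
qed


subsection \<open>Order convergence\<close>

definition decreases_to_zero :: "'i set \<Rightarrow> 'i rel \<Rightarrow> ('i \<Rightarrow> 'e::banach_lattice) \<Rightarrow> bool" where
  "decreases_to_zero I r y \<longleftrightarrow> (\<forall>(i, j)\<in>r. y j \<le> y i) \<and> isGlb UNIV (y ` I) 0"

definition order_conv :: "'i set \<Rightarrow> 'i rel \<Rightarrow> ('i \<Rightarrow> 'e::banach_lattice) \<Rightarrow> 'e \<Rightarrow> bool" where
  "order_conv I r x l \<longleftrightarrow>
     (\<exists>(B :: 'e idx set) s y. directed_set B s \<and> decreases_to_zero B s y \<and>
        (\<forall>b\<in>B. \<exists>i0\<in>I. \<forall>i\<in>I. (i0, i) \<in> r \<longrightarrow> \<bar>x i - l\<bar> \<le> y b))"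

lemma order_convI:
  fixes x :: "'i \<Rightarrow> 'e::banach_lattice" and y :: "'j \<Rightarrow> 'e"
  assumes "directed_set B s" "decreases_to_zero B s y"
    and "\<forall>b\<in>B. \<exists>i0\<in>I. \<forall>i\<in>I. (i0, i) \<in> r \<longrightarrow> \<bar>x i - l\<bar> \<le> y b"
  shows "order_conv I r x l"
proof -
  define C where "C = (\<lambda>b. (y b, UNIV :: 'e set)) ` B"
  define t where "t = {(p, q). p \<in> C \<and> q \<in> C \<and> fst q \<le> fst p}"
  have s: "B \<noteq> {}" "\<forall>i\<in>B. \<forall>j\<in>B. \<exists>k\<in>B. (i, k) \<in> s \<and> (j, k) \<in> s"
    using assms(1) by (auto simp: directed_set_def)
  have y: "\<And>i j. (i, j) \<in> s \<Longrightarrow> y j \<le> y i" "isGlb UNIV (y ` B) 0"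
    using assms(2) by (auto simp: decreases_to_zero_def)
  have "directed_set C t"
    unfolding directed_set_def
  proof (intro conjI ballI)
    show "C \<noteq> {}" using s by (simp add: C_def)
    show "preorder_on C t" by (auto simp: preorder_on_def refl_on_def trans_def t_def)
    fix p q assume "p \<in> C" "q \<in> C"
    then obtain i j where ij: "i \<in> B" "j \<in> B" "p = (y i, UNIV)" "q = (y j, UNIV)"
      by (auto simp: C_def)
    then obtain k where "k \<in> B" "(i, k) \<in> s" "(j, k) \<in> s" using s by blast
    then show "\<exists>k\<in>C. (p, k) \<in> t \<and> (q, k) \<in> t"
      using ij y by (intro bexI[of _ "(y k, UNIV)"]) (auto simp: t_def C_def)
  qed
  moreover have "fst ` C = y ` B" by (force simp: C_def)
  then have "decreases_to_zero C t fst"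
    using y by (auto simp: decreases_to_zero_def t_def)
  moreover have "\<forall>b\<in>C. \<exists>i0\<in>I. \<forall>i\<in>I. (i0, i) \<in> r \<longrightarrow> \<bar>x i - l\<bar> \<le> fst b"
    using assms(3) by (auto simp: C_def)
  ultimately show ?thesis unfolding order_conv_def by blast
qed

definition order_continuous_norm :: "'e::banach_lattice itself \<Rightarrow> bool" where
  "order_continuous_norm _ \<longleftrightarrow>
     (\<forall>(I :: 'e idx set) r (x :: 'e idx \<Rightarrow> 'e). directed_set I r \<and> decreases_to_zero I r x \<longrightarrow>
        ((\<lambda>i. norm (x i)) \<longlongrightarrow> 0) (tails I r))"


subsection \<open>Unbounded convergences\<close>

definition uo_null :: "'i set \<Rightarrow> 'i rel \<Rightarrow> ('i \<Rightarrow> 'e::banach_lattice) \<Rightarrow> bool" where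
  "uo_null I r x \<longleftrightarrow> (\<forall>u\<ge>0. order_conv I r (\<lambda>i. inf \<bar>x i\<bar> u) 0)"

definition un_null :: "'i set \<Rightarrow> 'i rel \<Rightarrow> ('i \<Rightarrow> 'e::banach_lattice) \<Rightarrow> bool" where
  "un_null I r x \<longleftrightarrow> (\<forall>u\<ge>0. ((\<lambda>i. inf \<bar>x i\<bar> u) \<longlongrightarrow> 0) (tails I r))"

definition uaw_null :: "'i set \<Rightarrow> 'i rel \<Rightarrow> ('i \<Rightarrow> 'e::banach_lattice) \<Rightarrow> bool" where
  "uaw_null I r x \<longleftrightarrow>
     (\<forall>u\<ge>0. \<forall>\<phi> :: 'e \<Rightarrow>\<^sub>L real. ((\<lambda>i. blinfun_apply \<phi> (inf \<bar>x i\<bar> u)) \<longlongrightarrow> 0) (tails I r))"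

text \<open>
  \<open>dual_representation J\<close>: via \<open>J\<close>, the Banach lattice \<open>'e\<close> is identified, isometrically and as an
  ordered space, with the norm dual of \<open>'g\<close>, ordered by \<open>\<phi> \<le> \<psi>\<close> iff \<open>\<phi> g \<le> \<psi> g\<close> for all \<open>g \<ge> 0\<close>.
\<close>

definition dual_representation ::
    "('e::banach_lattice \<Rightarrow> ('g::banach_lattice \<Rightarrow>\<^sub>L real)) \<Rightarrow> bool" where
  "dual_representation J \<longleftrightarrow> linear J \<and> bij J \<and> (\<forall>x. norm (J x) = norm x) \<and>
     (\<forall>x y. x \<le> y \<longleftrightarrow> (\<forall>g\<ge>0. blinfun_apply (J x) g \<le> blinfun_apply (J y) g))"

definition uaw_star_null ::
    "('e::banach_lattice \<Rightarrow> ('g::banach_lattice \<Rightarrow>\<^sub>L real)) \<Rightarrow>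
      'i set \<Rightarrow> 'i rel \<Rightarrow> ('i \<Rightarrow> 'e) \<Rightarrow> bool" where
  "uaw_star_null J I r x \<longleftrightarrow>
     (\<forall>u\<ge>0. \<forall>g. ((\<lambda>i. blinfun_apply (J (inf \<bar>x i\<bar> u)) g) \<longlongrightarrow> 0) (tails I r))"


subsection \<open>Disjoint nets\<close>

text \<open>
  Over an index set with a last element a disjoint net need not tend to anything in particular:
  every vector, indexed by a singleton, is one, so \<open>T x\<^sub>\<alpha> \<rightarrow> 0\<close> for all disjoint nets in that
  sense would mean \<open>T = 0\<close>. Conditions on disjoint nets are hence imposed only for index sets
  without a last element (\<open>no_last\<close>), such as the natural numbers.
\<close>

definition no_last :: "'i set \<Rightarrow> 'i rel \<Rightarrow> bool" where
  "no_last I r \<longleftrightarrow> (\<forall>i\<in>I. \<exists>j\<in>I. (j, i) \<notin> r)"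

definition disjoint_net :: "'i set \<Rightarrow> ('i \<Rightarrow> 'e::banach_lattice) \<Rightarrow> bool" where
  "disjoint_net I x \<longleftrightarrow> (\<forall>i\<in>I. \<forall>j\<in>I. i \<noteq> j \<longrightarrow> inf \<bar>x i\<bar> \<bar>x j\<bar> = 0)"

lemma disjoint_net_reindex:
  fixes T :: "'e::banach_lattice \<Rightarrow> 'f::banach_lattice" and x :: "'i \<Rightarrow> 'e"
  assumes T: "linear T"
    and *: "\<And>(J :: 'e idx set) s y. directed_set J s \<Longrightarrow> no_last J s \<Longrightarrow> disjoint_net J y \<Longrightarrow>
           ((\<lambda>j. T (y j)) \<longlongrightarrow> 0) (tails J s)"
    and dir: "directed_set I r" and nl: "no_last I r" and x: "disjoint_net I x"
  shows "((\<lambda>i. T (x i)) \<longlongrightarrow> 0) (tails I r)"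
proof (rule ccontr)
  assume "\<not> ?thesis"
  then obtain \<epsilon> where \<epsilon>: "\<epsilon> > 0" "\<not> eventually (\<lambda>i. dist (T (x i)) 0 < \<epsilon>) (tails I r)"
    by (auto simp: tendsto_iff)
  define K where "K = {i\<in>I. dist (T (x i)) 0 \<ge> \<epsilon>}"
  have cof: "\<exists>k\<in>K. (i, k) \<in> r" if "i \<in> I" for i
    using \<epsilon>(2) that unfolding eventually_tails[OF dir] K_def by (force simp: not_less)
  have r: "r \<subseteq> I \<times> I" "trans r" "I \<noteq> {}" "refl_on I r"
      "\<forall>i\<in>I. \<forall>j\<in>I. \<exists>k\<in>I. (i, k) \<in> r \<and> (j, k) \<in> r"
    using dir by (auto simp: directed_set_def preorder_on_def)
  have nz: "x k \<noteq> 0" if "k \<in> K" for k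
    using that \<epsilon>(1) linear_0[OF T] by (auto simp: K_def)
  have inj: "i = j" if "i \<in> K" "j \<in> K" "x i = x j" for i j
  proof (rule ccontr)
    assume "i \<noteq> j"
    then have "inf \<bar>x i\<bar> \<bar>x j\<bar> = 0" using x that unfolding disjoint_net_def K_def by blast
    then have "\<bar>x i\<bar> = 0" using that by simp
    then show False using nz that by simp
  qed
  define h where "h i = (x i, UNIV :: 'e set)" for i
  define J where "J = h ` K"
  define s where "s = {(h i, h j) | i j. i \<in> K \<and> j \<in> K \<and> (i, j) \<in> r}"
  have s_iff: "(h i, h j) \<in> s \<longleftrightarrow> (i, j) \<in> r" if "i \<in> K" "j \<in> K" for i j
    using that inj by (auto simp: s_def h_def)
  have KI: "K \<subseteq> I" by (auto simp: K_def)
  have J_dir: "directed_set J s"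
    unfolding directed_set_def
  proof (intro conjI ballI)
    show "J \<noteq> {}" using cof r by (auto simp: J_def)
    show "preorder_on J s"
      unfolding preorder_on_def
    proof (intro conjI)
      show "s \<subseteq> J \<times> J" by (auto simp: s_def J_def)
      show "refl_on J s"
        using r(4) KI s_iff by (auto simp: refl_on_def J_def)
      show "trans s"
      proof (rule transI)
        fix p q t assume pq: "(p, q) \<in> s" and qt: "(q, t) \<in> s"
        from pq obtain i j where 1: "i \<in> K" "j \<in> K" "p = h i" "q = h j" "(i, j) \<in> r"
          by (auto simp: s_def)
        from qt obtain j' k where 2: "j' \<in> K" "k \<in> K" "q = h j'" "t = h k" "(j', k) \<in> r"
          by (auto simp: s_def)
        have "j = j'" using 1 2 inj by (auto simp: h_def)
        then have "(i, k) \<in> r" using 1 2 r(2) by (auto dest: transD)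
        then show "(p, t) \<in> s" using 1 2 by (auto simp: s_def)
      qed
    qed
    fix p q assume "p \<in> J" "q \<in> J"
    then obtain i j where ij: "i \<in> K" "j \<in> K" "p = h i" "q = h j" by (auto simp: J_def)
    then obtain k where k: "k \<in> I" "(i, k) \<in> r" "(j, k) \<in> r" using r KI by blast
    then obtain k' where k': "k' \<in> K" "(k, k') \<in> r" using cof by blast
    then have "(i, k') \<in> r" "(j, k') \<in> r" using k r(2) by (auto dest: transD)
    then show "\<exists>k\<in>J. (p, k) \<in> s \<and> (q, k) \<in> s"
      using ij k' by (intro bexI[of _ "h k'"]) (auto simp: s_iff J_def)
  qed
  moreover have "no_last J s"
    unfolding no_last_def
  proof
    fix p assume "p \<in> J"
    then obtain i where i: "i \<in> K" "p = h i" by (auto simp: J_def)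
    then obtain j where j: "j \<in> I" "(j, i) \<notin> r" using nl KI by (auto simp: no_last_def)
    then obtain k where k: "k \<in> K" "(j, k) \<in> r" using cof by blast
    then have "(k, i) \<notin> r" using j r(2) by (auto dest: transD)
    then show "\<exists>q\<in>J. (q, p) \<notin> s" using i k by (auto simp: J_def s_iff)
  qed
  moreover have "disjoint_net J fst"
    using x by (auto simp: disjoint_net_def J_def h_def K_def)
  ultimately have "((\<lambda>j. T (fst j)) \<longlongrightarrow> 0) (tails J s)" by (rule *)
  then have "eventually (\<lambda>j. dist (T (fst j)) 0 < \<epsilon>) (tails J s)"
    using \<epsilon>(1) by (rule tendstoD)
  then obtain p where p: "p \<in> J" "\<And>q. q \<in> J \<Longrightarrow> (p, q) \<in> s \<Longrightarrow> dist (T (fst q)) 0 < \<epsilon>"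
    unfolding eventually_tails[OF J_dir] by blast
  then have "dist (T (fst p)) 0 < \<epsilon>"
    using J_dir by (auto simp: directed_set_def preorder_on_def refl_on_def)
  moreover have "dist (T (fst p)) 0 \<ge> \<epsilon>"
    using p(1) by (auto simp: J_def h_def K_def)
  ultimately show False by simp
qed

end

theory Submission
  imports Defs
begin

text \<open>
  Call an atom of norm one active if \<open>T\<close> does not vanish at it. Any two distinct atoms of norm one
  are disjoint. If there were infinitely many active atoms \<open>e\<^sub>n\<close>, the vectors
  \<open>x\<^sub>n = e\<^sub>n / \<parallel>T e\<^sub>n\<parallel>\<close> would form a disjoint sequence with \<open>\<parallel>T x\<^sub>n\<parallel> = 1\<close>. In every Banach lattice a
  disjoint sequence is \<open>uo\<close>-null (\<open>disjoint_seq_uo_null\<close>), \<open>uaw\<close>-null (\<open>disjoint_seq_uaw_null\<close>), and in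
  a dual \<open>uaw*\<close>-null; if the norm is order continuous, \<open>uo\<close>-null nets are \<open>un\<close>-null. So each of the
  five conditions forces \<open>T x\<^sub>n \<rightarrow> 0\<close>, a contradiction, and the active atoms form a finite set \<open>A\<close>.

  It remains to see that \<open>A\<close> generates the carrier (\<open>carrier_eq_band_hull\<close>). Each vector \<open>x\<close> has a
  coefficient \<open>t\<close> at an atom \<open>e\<close>, the unique number for which \<open>x - t e\<close> is disjoint from \<open>e\<close>.
  This coefficient is a positive linear functional, and perturbing the modulus by a multiple of it
  shows that \<open>\<bar>T\<bar> e \<le> \<bar>T e\<bar>\<close> (\<open>modulus_atom_le\<close>). Thus every atom in the kernel of \<open>T\<close> lies in the
  null ideal of \<open>\<bar>T\<bar>\<close>, to which the carrier is disjoint, whereas every active atom lies in the carrier.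
  If \<open>x\<close> belongs to the carrier, subtract from \<open>\<bar>x\<bar>\<close> its components along the atoms of \<open>A\<close>. The
  rest is disjoint from all atoms, so it is zero because the lattice is atomic. Hence \<open>\<bar>x\<bar>\<close> lies in the
  span of \<open>A\<close>, and \<open>x\<close> in the band generated by \<open>A\<close>.
\<close>

section \<open>Disjointness and the Archimedean property\<close>

lemma norm_le_of_nonneg_le:
  fixes x y :: "'e::banach_lattice"
  assumes "0 \<le> x" "x \<le> y"
  shows "norm x \<le> norm y"
  using assms by (intro norm_abs_mono) (simp add: abs_of_nonneg order_trans[OF assms])

lemma norm_abs_eq: "norm \<bar>x\<bar> = norm (x :: 'e::banach_lattice)"
  by (intro antisym norm_abs_mono) auto

text \<open>
  The norm makes the order Archimedean: \<open>x\<^sup>+ \<le> \<delta> y\<close> for all small \<open>\<delta>\<close> forces the norm of \<open>x\<^sup>+\<close>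
  to vanish.
\<close>

lemma archimedean_le_zero:
  fixes x y :: "'e::banach_lattice"
  assumes "0 \<le> y" and le: "\<And>\<delta>. 0 < \<delta> \<Longrightarrow> \<delta> \<le> 1 \<Longrightarrow> x \<le> \<delta> *\<^sub>R y"
  shows "x \<le> 0"
proof -
  have bound: "norm (sup x 0) \<le> \<delta> * norm y" if "0 < \<delta>" "\<delta> \<le> 1" for \<delta>
    using norm_le_of_nonneg_le[of "sup x 0" "\<delta> *\<^sub>R y"] le[OF that] that assms(1)
    by (simp add: scaleR_nonneg_nonneg)
  have "norm (sup x 0) = 0"
  proof (rule ccontr)
    assume "norm (sup x 0) \<noteq> 0"
    then obtain n :: nat where n: "norm y < real n * norm (sup x 0)"
      using reals_Archimedean3[of "norm (sup x 0)"] by auto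
    have "n > 0" using n by (cases n) (auto simp: not_less)
    then have "norm (sup x 0) \<le> norm y / real n"
      using bound[of "1 / real n"] by (simp add: field_simps)
    with n \<open>n > 0\<close> show False by (simp add: field_simps)
  qed
  then have "sup x 0 = 0" by simp
  then show ?thesis using sup_ge1[of x 0] by simp
qed

lemma le_zero_of_multiples_bounded:
  fixes x y :: "'e::banach_lattice"
  assumes "0 \<le> x" and le: "\<And>n::nat. real n *\<^sub>R x \<le> y"
  shows "x = 0"
proof -
  have "0 \<le> y" using le[of 0] by simp
  have "x \<le> 0"
  proof (rule archimedean_le_zero[OF \<open>0 \<le> y\<close>])
    fix \<delta> :: real assume "0 < \<delta>"
    obtain n :: nat where n: "inverse \<delta> \<le> real n" using real_arch_simple by blast
    have "1 \<le> \<delta> * real n" using n \<open>0 < \<delta>\<close> by (simp add: field_simps)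
    then have "1 *\<^sub>R x \<le> (\<delta> * real n) *\<^sub>R x" using assms(1) by (rule scaleR_right_mono)
    also have "\<dots> = \<delta> *\<^sub>R (real n *\<^sub>R x)" by simp
    also have "\<dots> \<le> \<delta> *\<^sub>R y" using le[of n] \<open>0 < \<delta>\<close> by (intro scaleR_left_mono) auto
    finally show "x \<le> \<delta> *\<^sub>R y" by simp
  qed
  with assms(1) show ?thesis by (rule antisym[rotated])
qed

lemma pos_part_disjoint_neg_part:
  fixes x :: "'e::banach_lattice"
  shows "inf (sup x 0) (sup (- x) 0) = 0"
proof -
  have "sup (- x) 0 = sup x 0 - x"
    using add_sup_distrib_left[of "- x" x 0] by (simp add: sup_commute)
  then have "inf (sup x 0) (sup (- x) 0) = sup x 0 + inf 0 (- x)"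
    by (simp add: add_inf_distrib_left)
  also have "inf 0 (- x) = - sup x 0"
    by (simp add: neg_sup_eq_inf inf_commute)
  finally show ?thesis by (metis add.right_inverse)
qed

lemma inf_zero_mono:
  fixes x y :: "'e::banach_lattice"
  assumes "inf x y = 0" "0 \<le> x'" "x' \<le> x" "0 \<le> y'" "y' \<le> y"
  shows "inf x' y' = 0"
  using inf_mono[OF assms(3,5)] assms by (intro antisym) auto

lemma sum_le_of_disjoint:
  fixes x y u :: "'e::banach_lattice"
  assumes "inf x y = 0" "x \<le> u" "y \<le> u"
  shows "x + y \<le> u"
  using add_eq_inf_sup[of x y] assms by simp

lemma inf_add_le:
  fixes x y z :: "'e::banach_lattice"
  assumes "0 \<le> x" "0 \<le> y" "0 \<le> z"
  shows "inf (x + y) z \<le> inf x z + inf y z"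
proof -
  define p where "p = inf (x + y) z"
  define q where "q = inf y z"
  have p: "p \<le> x + y" "p \<le> z" and "0 \<le> q" using assms by (auto simp: p_def q_def)
  have "p - x \<le> y" using p by (simp add: algebra_simps)
  moreover have "p - x \<le> z" using p(2) assms(1) by (metis diff_left_mono diff_zero order_trans)
  ultimately have "p - x \<le> q" by (simp add: q_def)
  then have "p - q \<le> x" by (simp add: algebra_simps)
  moreover have "p - q \<le> z" using p(2) \<open>0 \<le> q\<close> by (metis diff_left_mono diff_zero order_trans)
  ultimately have "p - q \<le> inf x z" by simp
  then have "p \<le> inf x z + q" by (simp only: diff_le_eq)
  then show ?thesis by (simp only: p_def q_def)
qed

lemma inf_add_zero:
  fixes x y z :: "'e::banach_lattice"
  assumes "0 \<le> x" "0 \<le> y" "0 \<le> z" "inf x z = 0" "inf y z = 0"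
  shows "inf (x + y) z = 0"
  using inf_add_le[OF assms(1-3)] assms by (intro antisym) auto

lemma inf_scale_zero:
  fixes x y :: "'e::banach_lattice"
  assumes "0 \<le> x" "0 \<le> y" "inf x y = 0" "0 \<le> c"
  shows "inf (c *\<^sub>R x) y = 0"
proof -
  obtain n :: nat where n: "c \<le> real n" using real_arch_simple by blast
  have "inf (real k *\<^sub>R x) y = 0" for k :: nat
  proof (induction k)
    case (Suc k)
    have "real (Suc k) *\<^sub>R x = x + real k *\<^sub>R x" by (simp add: algebra_simps)
    then show ?case using inf_add_zero[of x "real k *\<^sub>R x" y] Suc assms
      by (simp add: scaleR_nonneg_nonneg)
  qed (use assms(2) in \<open>simp add: inf_absorb1\<close>)
  from inf_zero_mono[OF this[of n]] show ?thesis
    using n assms by (simp add: scaleR_nonneg_nonneg scaleR_right_mono)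
qed

lemma abs_scaleR_le: "\<bar>c *\<^sub>R x\<bar> \<le> \<bar>c\<bar> *\<^sub>R \<bar>x :: 'e::banach_lattice\<bar>"
proof (cases "0 \<le> c")
  case True
  show ?thesis using True scaleR_left_mono[OF abs_ge_self[of x] True]
      scaleR_left_mono[OF abs_ge_minus_self[of x] True]
    by (intro abs_leI) auto
next
  case False
  then have c: "0 \<le> - c" by simp
  show ?thesis using False scaleR_left_mono[OF abs_ge_self[of x] c]
      scaleR_left_mono[OF abs_ge_minus_self[of x] c]
    by (intro abs_leI) auto
qed

text \<open>Disjoint elements below \<open>u\<close> add up to their supremum, hence to something below \<open>u\<close>.\<close>

lemma disjoint_sum_le:
  fixes z :: "'i \<Rightarrow> 'e::banach_lattice"
  assumes "finite S" "\<And>i. i \<in> S \<Longrightarrow> 0 \<le> z i" "\<And>i. i \<in> S \<Longrightarrow> z i \<le> u" "0 \<le> u"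
    and "\<And>i j. i \<in> S \<Longrightarrow> j \<in> S \<Longrightarrow> i \<noteq> j \<Longrightarrow> inf (z i) (z j) = 0"
  shows "sum z S \<le> u"
proof -
  have "S' \<subseteq> S \<Longrightarrow> sum z S' \<le> u \<and> (\<forall>j\<in>S - S'. inf (sum z S') (z j) = 0)" if "finite S'" for S'
    using that
  proof (induction S' rule: finite_induct)
    case empty
    then show ?case using assms by (auto intro!: antisym)
  next
    case (insert i S')
    have nn: "0 \<le> sum z S'" using insert.prems assms(2) by (intro sum_nonneg) auto
    have "inf (sum z S') (z i) = 0" "sum z S' \<le> u" using insert by auto
    then have "z i + sum z S' \<le> u"
      using sum_le_of_disjoint[of "z i" "sum z S'" u] insert.prems assms(3) by (simp add: inf_commute)
    moreover have "inf (z i + sum z S') (z j) = 0" if "j \<in> S - insert i S'" for j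
      using that insert nn assms by (intro inf_add_zero) auto
    ultimately show ?case using insert.hyps by simp
  qed
  from this[of S] show ?thesis using assms(1) by auto
qed


section \<open>Disjoint complements are bands\<close>

lemma disj_compl_solid:
  assumes "y \<in> disj_compl A" "\<bar>x\<bar> \<le> \<bar>y\<bar>"
  shows "x \<in> disj_compl A"
  unfolding disj_compl_def
proof (safe)
  fix a assume "a \<in> A"
  then have "inf \<bar>y\<bar> \<bar>a\<bar> = 0" using assms(1) by (simp add: disj_compl_def)
  then show "inf \<bar>x\<bar> \<bar>a\<bar> = 0" by (rule inf_zero_mono) (use assms(2) in auto)
qed

lemma subspace_disj_compl: "subspace (disj_compl (A :: 'e::banach_lattice set))"
proof (rule subspaceI)
  show "0 \<in> disj_compl A" by (simp add: disj_compl_def inf_absorb1)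
next
  fix x y assume xy: "x \<in> disj_compl A" "y \<in> disj_compl A"
  show "x + y \<in> disj_compl A"
    unfolding disj_compl_def
  proof (safe)
    fix a assume "a \<in> A"
    then have "inf (\<bar>x\<bar> + \<bar>y\<bar>) \<bar>a\<bar> = 0"
      using xy by (intro inf_add_zero) (auto simp: disj_compl_def)
    then show "inf \<bar>x + y\<bar> \<bar>a\<bar> = 0"
      by (rule inf_zero_mono) (auto simp: abs_triangle_ineq)
  qed
next
  fix c :: real and x assume x: "x \<in> disj_compl A"
  show "c *\<^sub>R x \<in> disj_compl A"
    unfolding disj_compl_def
  proof (safe)
    fix a assume "a \<in> A"
    then have "inf (\<bar>c\<bar> *\<^sub>R \<bar>x\<bar>) \<bar>a\<bar> = 0"
      using x by (intro inf_scale_zero) (auto simp: disj_compl_def)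
    then show "inf \<bar>c *\<^sub>R x\<bar> \<bar>a\<bar> = 0"
      by (rule inf_zero_mono) (auto simp: abs_scaleR_le)
  qed
qed

text \<open>
  For closure under suprema let \<open>s\<close> be the supremum of \<open>D\<close> and \<open>p = s\<^sup>+ \<and> \<bar>a\<bar>\<close>. Every \<open>d\<^sup>+\<close> with
  \<open>d \<in> D\<close> is disjoint from \<open>p\<close> and both lie below \<open>s\<^sup>+\<close>, so \<open>d\<^sup>+ + p \<le> s\<^sup>+\<close>. As also
  \<open>s\<^sup>- \<le> d\<^sup>-\<close>, the vector \<open>s - p\<close> is an upper bound of \<open>D\<close>, whence \<open>p = 0\<close>. The negative part of \<open>s\<close> lies
  below \<open>\<bar>d\<bar>\<close> for any \<open>d \<in> D\<close>, so it is disjoint from \<open>\<bar>a\<bar>\<close> too.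
\<close>

lemma disj_compl_isLub:
  fixes A :: "'e::banach_lattice set"
  assumes D: "D \<subseteq> disj_compl A" "D \<noteq> {}" and s: "isLub UNIV D s"
  shows "s \<in> disj_compl A"
  unfolding disj_compl_def
proof (safe)
  fix a assume a: "a \<in> A"
  define sp sm where "sp = sup s 0" and "sm = sup (- s) 0"
  have s_eq: "s = sp - sm" and abs_s: "\<bar>s\<bar> = sp + sm"
    using prts[of s] abs_prts[of s] by (auto simp: sp_def sm_def pprt_def nprt_def)
  have ub: "d \<le> s" if "d \<in> D" for d using s that by (auto simp: isLub_def leastP_def isUb_def setle_def)
  have least: "s \<le> t" if "\<And>d. d \<in> D \<Longrightarrow> d \<le> t" for t
    using s that by (auto simp: isLub_def leastP_def isUb_def setle_def setge_def)
  have nn: "0 \<le> sp" "0 \<le> sm" by (auto simp: sp_def sm_def)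
  define p where "p = inf sp \<bar>a\<bar>"
  have p: "0 \<le> p" "p \<le> sp" "p \<le> \<bar>a\<bar>" using nn by (auto simp: p_def)
  have disj: "inf \<bar>d\<bar> \<bar>a\<bar> = 0" if "d \<in> D" for d using D that a by (auto simp: disj_compl_def)
  have "s \<le> s - p"
  proof (rule least)
    fix d assume d: "d \<in> D"
    have "inf (sup d 0) p = 0"
      using disj[OF d] by (rule inf_zero_mono) (use p in \<open>auto simp: abs_ge_self\<close>)
    moreover have "sup d 0 \<le> sp" using ub[OF d] by (auto simp: sp_def intro: le_supI1)
    ultimately have 1: "sup d 0 + p \<le> sp" using p by (intro sum_le_of_disjoint)
    have 2: "sm \<le> sup (- d) 0" using ub[OF d] by (auto simp: sm_def intro: le_supI1)
    have "d = sup d 0 - sup (- d) 0" using prts[of d] by (simp add: pprt_def nprt_def)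
    also have "\<dots> \<le> (sp - p) - sm" using 1 2 by (intro diff_mono) (auto simp: algebra_simps)
    finally show "d \<le> s - p" by (simp add: s_eq algebra_simps)
  qed
  then have "p = 0" using p(1) by (intro antisym) auto
  obtain d where d: "d \<in> D" using D by auto
  have "sm \<le> \<bar>d\<bar>" using ub[OF d] by (auto simp: sm_def intro: order_trans[OF _ abs_ge_minus_self])
  then have "inf sm \<bar>a\<bar> = 0" using disj[OF d] nn by (intro inf_zero_mono[OF disj[OF d]]) auto
  with \<open>p = 0\<close> show "inf \<bar>s\<bar> \<bar>a\<bar> = 0"
    unfolding abs_s p_def using nn by (intro inf_add_zero) auto
qed

lemma band_disj_compl: "band (disj_compl (A :: 'e::banach_lattice set))"
  unfolding band_def
proof (intro conjI allI impI)
  show "subspace (disj_compl A)" by (rule subspace_disj_compl)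
  show "x \<in> disj_compl A" if "y \<in> disj_compl A \<and> \<bar>x\<bar> \<le> \<bar>y\<bar>" for x y
    using that by (auto intro: disj_compl_solid)
  show "s \<in> disj_compl A" if "D \<subseteq> disj_compl A \<and> D \<noteq> {} \<and> isLub UNIV D s" for D s
    using that by (auto intro: disj_compl_isLub)
qed

text \<open>
  In an atomic Banach lattice the atoms separate points: the disjoint complement of \<open>x\<close> is a
  band, so if it contains all atoms it contains \<open>x\<close> itself.
\<close>

lemma disjoint_from_atoms_zero:
  fixes x :: "'e::banach_lattice"
  assumes "atomic_lattice TYPE('e)" and "\<And>e. atom e \<Longrightarrow> inf \<bar>x\<bar> \<bar>e\<bar> = 0"
  shows "x = 0"
proof -
  have "{e. atom e} \<subseteq> disj_compl {x}"
    using assms(2) by (auto simp: disj_compl_def inf_commute)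
  then have "band hull {e. atom e} \<subseteq> disj_compl {x}"
    by (intro hull_minimal band_disj_compl)
  then have "x \<in> disj_compl {x}"
    using assms(1) by (auto simp: atomic_lattice_def)
  then show ?thesis by (simp add: disj_compl_def)
qed


section \<open>The coefficient of a vector at an atom\<close>

lemma atom_pos: "atom e \<Longrightarrow> 0 < e"
  by (simp add: atom_def)

lemma atom_abs: "atom e \<Longrightarrow> \<bar>e\<bar> = e"
  by (simp add: atom_def abs_of_nonneg less_imp_le)

lemma atom_scale:
  fixes e :: "'e::banach_lattice"
  assumes e: "atom e" and c: "0 < c"
  shows "atom (c *\<^sub>R e)"
  unfolding atom_def
proof (intro conjI ballI impI)
  show "0 < c *\<^sub>R e" using c atom_pos[OF e] by (simp add: less_le scaleR_nonneg_nonneg)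
  fix u v assume uv: "u \<in> {0..c *\<^sub>R e}" "v \<in> {0..c *\<^sub>R e}" "inf u v = 0"
  have c': "0 \<le> inverse c" using c by simp
  have scale: "inverse c *\<^sub>R w \<in> {0..e}" if "w \<in> {0..c *\<^sub>R e}" for w
    using that scaleR_left_mono[OF _ c', of w "c *\<^sub>R e"] c by (auto simp: scaleR_nonneg_nonneg)
  have "inf (inverse c *\<^sub>R u) v = 0" using uv c' by (intro inf_scale_zero) auto
  then have "inf (inverse c *\<^sub>R v) (inverse c *\<^sub>R u) = 0"
    using uv c' by (intro inf_scale_zero) (auto simp: inf_commute scaleR_nonneg_nonneg)
  then have "inf (inverse c *\<^sub>R u) (inverse c *\<^sub>R v) = 0" by (simp add: inf_commute)
  then have "inverse c *\<^sub>R u = 0 \<or> inverse c *\<^sub>R v = 0"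
    using e scale[OF uv(1)] scale[OF uv(2)] unfolding atom_def by blast
  then show "u = 0 \<or> v = 0" using c by simp
qed

text \<open>
  Put \<open>w = y \<and> e\<close>. For \<open>\<delta> \<le> 1\<close> the two parts \<open>(w - \<delta> e)\<^sup>+\<close> and \<open>(w - \<delta> e)\<^sup>-\<close> are disjoint elements
  of \<open>[0, e]\<close>, so one of them vanishes. It is not the second, as that means \<open>\<delta> e \<le> w \<le> y\<close>;
  hence \<open>w \<le> \<delta> e\<close> for all such \<open>\<delta>\<close>, which forces \<open>w = 0\<close>.
\<close>

lemma atom_disjoint_of_no_multiple:
  fixes e y :: "'e::banach_lattice"
  assumes e: "atom e" and y: "0 \<le> y" and no: "\<And>\<delta>. 0 < \<delta> \<Longrightarrow> \<not> \<delta> *\<^sub>R e \<le> y"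
  shows "inf y e = 0"
proof -
  define w where "w = inf y e"
  have e0: "0 \<le> e" using atom_pos[OF e] by simp
  have w: "0 \<le> w" "w \<le> y" "w \<le> e" using y e0 by (auto simp: w_def)
  have "w \<le> \<delta> *\<^sub>R e" if \<delta>: "0 < \<delta>" "\<delta> \<le> 1" for \<delta>
  proof -
    define d where "d = w - \<delta> *\<^sub>R e"
    have de: "0 \<le> \<delta> *\<^sub>R e" "\<delta> *\<^sub>R e \<le> e"
      using \<delta> e0 scaleR_right_mono[of \<delta> 1 e] by (auto simp: scaleR_nonneg_nonneg)
    have "d \<le> w" using de by (simp add: d_def)
    then have "sup d 0 \<in> {0..e}" using w by auto
    moreover have "- d \<le> \<delta> *\<^sub>R e" using w by (simp add: d_def)
    then have "sup (- d) 0 \<in> {0..e}" using de e0 by (auto simp del: minus_le_iff intro: order_trans)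
    ultimately consider "sup d 0 = 0" | "sup (- d) 0 = 0"
      using e pos_part_disjoint_neg_part[of d] unfolding atom_def by blast
    then show ?thesis
    proof cases
      case 1
      then have "d \<le> 0" by (metis sup_ge1)
      then show ?thesis by (simp add: d_def)
    next
      case 2
      then have "- d \<le> 0" by (metis sup_ge1)
      then have "\<delta> *\<^sub>R e \<le> w" by (simp add: d_def)
      then show ?thesis using no[OF \<delta>(1)] w(2) order_trans by blast
    qed
  qed
  then have "w \<le> 0" by (rule archimedean_le_zero[OF e0])
  then show ?thesis using w(1) by (simp add: w_def antisym)
qed

text \<open>
  The component of \<open>x \<ge> 0\<close> along \<open>e\<close> is the largest multiple of \<open>e\<close> below \<open>x\<close>; the norm bounds
  these multiples and the Archimedean property gives that their supremum is attained.
\<close>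

lemma atom_decomp_nonneg:
  fixes e x :: "'e::banach_lattice"
  assumes e: "atom e" and x: "0 \<le> x"
  shows "\<exists>t\<ge>0. t *\<^sub>R e \<le> x \<and> x - t *\<^sub>R e \<in> disj_compl {e}"
proof -
  define L where "L = {t. 0 \<le> t \<and> t *\<^sub>R e \<le> x}"
  have e0: "0 \<le> e" and ne: "norm e > 0" using atom_pos[OF e] by auto
  have zero: "0 \<in> L" using x by (simp add: L_def)
  have "t \<le> norm x / norm e" if "t \<in> L" for t
    using norm_le_of_nonneg_le[of "t *\<^sub>R e" x] that e0 ne
    by (simp add: L_def scaleR_nonneg_nonneg field_simps)
  then have bdd: "bdd_above L" by (rule bdd_aboveI)
  define t where "t = Sup L"
  have t0: "0 \<le> t" unfolding t_def by (rule cSup_upper[OF zero bdd])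
  have "t *\<^sub>R e - x \<le> 0"
  proof (rule archimedean_le_zero[OF e0])
    fix \<delta> :: real assume "0 < \<delta>"
    then obtain l where l: "l \<in> L" "t - \<delta> < l"
      using less_cSup_iff[OF _ bdd, of "t - \<delta>"] zero by (auto simp: t_def)
    have "(t - \<delta>) *\<^sub>R e \<le> l *\<^sub>R e" using l e0 by (intro scaleR_right_mono) auto
    also have "\<dots> \<le> x" using l by (simp add: L_def)
    finally show "t *\<^sub>R e - x \<le> \<delta> *\<^sub>R e" by (simp add: algebra_simps)
  qed
  then have tx: "t *\<^sub>R e \<le> x" by simp
  define y where "y = x - t *\<^sub>R e"
  have "inf y e = 0"
  proof (rule atom_disjoint_of_no_multiple[OF e])
    show "0 \<le> y" using tx by (simp add: y_def)
    fix \<delta> :: real assume "0 < \<delta>"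
    show "\<not> \<delta> *\<^sub>R e \<le> y"
    proof
      assume "\<delta> *\<^sub>R e \<le> y"
      then have "t + \<delta> \<in> L" using \<open>0 < \<delta>\<close> t0 by (simp add: L_def y_def algebra_simps)
      from cSup_upper[OF this bdd] show False using \<open>0 < \<delta>\<close> by (simp add: t_def)
    qed
  qed
  moreover have "\<bar>y\<bar> = y" using tx by (simp add: y_def)
  ultimately have "y \<in> disj_compl {e}" by (simp add: disj_compl_def atom_abs[OF e])
  with t0 tx show ?thesis by (auto simp: y_def)
qed

definition atom_coeff :: "'e::banach_lattice \<Rightarrow> 'e \<Rightarrow> real" where
  "atom_coeff e x = (THE t. x - t *\<^sub>R e \<in> disj_compl {e})"

lemma scaled_atom_in_compl:
  assumes e: "atom e" and t: "t *\<^sub>R e \<in> disj_compl {e}"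
  shows "t = 0"
proof (rule ccontr)
  assume "t \<noteq> 0"
  then have "e \<in> disj_compl {e}"
    using subspace_scale[OF subspace_disj_compl t, of "inverse t"] by simp
  then show False using atom_pos[OF e] by (simp add: disj_compl_def)
qed

lemma atom_coeff_eqI:
  fixes e x :: "'e::banach_lattice"
  assumes e: "atom e" and t: "x - t *\<^sub>R e \<in> disj_compl {e}"
  shows "atom_coeff e x = t"
  unfolding atom_coeff_def
proof (rule the_equality)
  show "x - t *\<^sub>R e \<in> disj_compl {e}" by (rule t)
next
  fix s assume "x - s *\<^sub>R e \<in> disj_compl {e}"
  from subspace_diff[OF subspace_disj_compl t this] have "(s - t) *\<^sub>R e \<in> disj_compl {e}"
    by (simp add: algebra_simps)
  then show "s = t" using scaled_atom_in_compl[OF e] by fastforce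
qed

lemma atom_coeff_decomp:
  fixes e x :: "'e::banach_lattice"
  assumes e: "atom e"
  shows "x - atom_coeff e x *\<^sub>R e \<in> disj_compl {e}"
proof -
  have x: "x = sup x 0 - sup (- x) 0" using prts[of x] by (simp add: pprt_def nprt_def)
  obtain s t where "sup x 0 - s *\<^sub>R e \<in> disj_compl {e}" "sup (- x) 0 - t *\<^sub>R e \<in> disj_compl {e}"
    using atom_decomp_nonneg[OF e] by (meson sup_ge2)
  from subspace_diff[OF subspace_disj_compl this]
  have *: "(sup x 0 - sup (- x) 0) - (s - t) *\<^sub>R e \<in> disj_compl {e}"
    by (simp only: algebra_simps)
  have "x - (s - t) *\<^sub>R e \<in> disj_compl {e}" using * by (simp only: x[symmetric])
  then show ?thesis using atom_coeff_eqI[OF e] by simp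
qed

lemma atom_coeff_nonneg:
  fixes e x :: "'e::banach_lattice"
  assumes "atom e" "0 \<le> x"
  shows "0 \<le> atom_coeff e x" "atom_coeff e x *\<^sub>R e \<le> x"
  using atom_decomp_nonneg[OF assms] atom_coeff_eqI[OF assms(1)] by auto

lemma linear_atom_coeff:
  fixes e :: "'e::banach_lattice"
  assumes e: "atom e"
  shows "linear (atom_coeff e)"
proof (rule linearI)
  fix x y :: 'e and c :: real
  show "atom_coeff e (x + y) = atom_coeff e x + atom_coeff e y"
    using subspace_add[OF subspace_disj_compl atom_coeff_decomp[OF e, of x] atom_coeff_decomp[OF e, of y]]
    by (intro atom_coeff_eqI[OF e]) (simp add: algebra_simps)
  show "atom_coeff e (c *\<^sub>R x) = c *\<^sub>R atom_coeff e x"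
    using subspace_scale[OF subspace_disj_compl atom_coeff_decomp[OF e, of x], of c]
    by (intro atom_coeff_eqI[OF e]) (simp add: algebra_simps)
qed

lemma atom_coeff_self: "atom e \<Longrightarrow> atom_coeff e e = 1"
  by (rule atom_coeff_eqI) (auto simp: subspace_0[OF subspace_disj_compl])

text \<open>
  Splitting one atom \<open>a\<close> along another atom \<open>e\<close> gives two disjoint elements of \<open>[0, a]\<close>, one of
  which must be zero. Normalisation turns proportional atoms into equal ones.
\<close>

lemma unit_atoms_disjoint:
  fixes a e :: "'e::banach_lattice"
  assumes a: "atom a" "norm a = 1" and e: "atom e" "norm e = 1" and "a \<noteq> e"
  shows "inf a e = 0"
proof -
  define t where "t = atom_coeff e a"
  define y where "y = a - t *\<^sub>R e"
  have a0: "0 \<le> a" and e0: "0 \<le> e" using atom_pos[OF a(1)] atom_pos[OF e(1)] by auto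
  have t: "0 \<le> t" "t *\<^sub>R e \<le> a" using atom_coeff_nonneg[OF e(1) a0] by (auto simp: t_def)
  have y0: "0 \<le> y" using t by (simp add: y_def)
  have "y \<in> disj_compl {e}" using atom_coeff_decomp[OF e(1)] by (simp add: y_def t_def)
  then have ye: "inf y e = 0" using y0 atom_abs[OF e(1)] by (simp add: disj_compl_def)
  have te: "0 \<le> t *\<^sub>R e" using t e0 by (simp add: scaleR_nonneg_nonneg)
  have "inf (t *\<^sub>R e) y = 0"
    using ye y0 e0 t by (intro inf_scale_zero) (auto simp: inf_commute)
  moreover have "t *\<^sub>R e \<in> {0..a}" "y \<in> {0..a}" using t te y0 by (auto simp: y_def)
  ultimately consider "t *\<^sub>R e = 0" | "y = 0" using a(1) unfolding atom_def by blast
  then show ?thesis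
  proof cases
    case 1
    then show ?thesis using ye by (simp only: y_def diff_0_right)
  next
    case 2
    then have "a = t *\<^sub>R e" by (simp add: y_def)
    moreover from this have "t = 1" using a(2) e(2) t(1) by simp
    ultimately show ?thesis using assms(5) by simp
  qed
qed


section \<open>The modulus at atoms\<close>

lemma modulus_dominates:
  assumes "is_modulus T M" "0 \<le> x"
  shows "T x \<le> M x" "- T x \<le> M x"
proof -
  have "0 \<le> M x - T x" "0 \<le> M x - - T x" using assms unfolding is_modulus_def op_le_def by blast+
  then show "T x \<le> M x" "- T x \<le> M x" by (simp_all only: diff_ge_0_iff_ge)
qed

lemma modulus_nonneg:
  assumes "is_modulus T M" "0 \<le> x"
  shows "0 \<le> M x"
  using abs_leI[OF modulus_dominates[OF assms]] abs_ge_zero order_trans by blast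

text \<open>
  No Riesz--Kantorovich formula is at hand, since the codomain need not be Dedekind complete.
  Instead the modulus is lowered along \<open>e\<close>: replacing its value at \<open>e\<close> by \<open>\<bar>T e\<bar>\<close> and keeping it on
  the disjoint complement of \<open>e\<close> still gives an upper bound of \<open>T\<close> and \<open>- T\<close>.
\<close>

lemma modulus_atom_le:
  fixes T :: "'e::banach_lattice \<Rightarrow> 'f::banach_lattice"
  assumes M: "is_modulus T M" and T: "linear T" and e: "atom e"
  shows "M e \<le> \<bar>T e\<bar>"
proof -
  define S where "S x = M x + atom_coeff e x *\<^sub>R (\<bar>T e\<bar> - M e)" for x
  have lM: "linear M" using M by (simp add: is_modulus_def)
  have lS: "linear S"
    using linear_add[OF lM] linear_scale[OF lM]
      linear_add[OF linear_atom_coeff[OF e]] linear_scale[OF linear_atom_coeff[OF e]]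
    unfolding S_def by (intro linearI) (simp_all add: algebra_simps)
  have dom: "T x \<le> S x" "- T x \<le> S x" if x: "0 \<le> x" for x
  proof -
    define t where "t = atom_coeff e x"
    define y where "y = x - t *\<^sub>R e"
    have t: "0 \<le> t" "0 \<le> y" using atom_coeff_nonneg[OF e x] by (auto simp: t_def y_def)
    have Sx: "S x = M y + t *\<^sub>R \<bar>T e\<bar>"
      by (simp add: S_def y_def t_def linear_diff[OF lM] linear_scale[OF lM] algebra_simps)
    have Tx: "T x = T y + t *\<^sub>R T e"
      by (simp add: y_def linear_diff[OF T] linear_scale[OF T])
    note y = modulus_dominates[OF M t(2)]
    have "t *\<^sub>R T e \<le> t *\<^sub>R \<bar>T e\<bar>" "t *\<^sub>R (- T e) \<le> t *\<^sub>R \<bar>T e\<bar>"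
      using t by (intro scaleR_left_mono abs_ge_self abs_ge_minus_self; simp)+
    from add_mono[OF y(1) this(1)] add_mono[OF y(2) this(2)]
    show "T x \<le> S x" "- T x \<le> S x" unfolding Sx Tx by (simp_all only: minus_add_distrib scaleR_minus_right)
  qed
  have "op_le T S" "op_le (\<lambda>x. - T x) S"
    using dom unfolding op_le_def by (auto simp only: diff_ge_0_iff_ge)
  with M lS have "op_le M S" unfolding is_modulus_def by blast
  then have "0 \<le> S e - M e" using atom_pos[OF e] by (simp add: op_le_def less_imp_le)
  then show ?thesis by (simp add: S_def atom_coeff_self[OF e])
qed

section \<open>Disjoint sequences are null for the unbounded convergences\<close>

text \<open>
  Suprema of the tails of \<open>z\<close> need not exist, so their place is taken by the set \<open>D\<close> of all upper
  bounds of tails; the claim is that \<open>D\<close> has infimum \<open>0\<close>. Let \<open>p = w\<^sup>+\<close>, a lower bound of \<open>D\<close>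
  because \<open>D\<close> consists of positive vectors. If \<open>p' \<ge> 0\<close> is a lower bound and \<open>v \<in> D\<close>, then \<open>v - v \<and> z k \<in> D\<close>, because \<open>v \<and> z k\<close> is disjoint
  from all later terms; hence \<open>p' + p' \<and> z k\<close> is again a lower bound. Iterating from \<open>p\<close> yields
  \<open>p + n (p \<and> z k) \<le> u\<close> for all \<open>n\<close>, so \<open>p\<close> is disjoint from every \<open>z k\<close>. But then \<open>v - p \<in> D\<close> for all
  \<open>v \<in> D\<close>, and iterating this yields \<open>n p \<le> u\<close>, so \<open>p = 0\<close>.
\<close>

lemma tail_bounds_inf_zero:
  fixes z :: "nat \<Rightarrow> 'e::banach_lattice"
  assumes z0: "\<And>n. 0 \<le> z n" and zu: "\<And>n. z n \<le> u"
    and disj: "\<And>m n. m \<noteq> n \<Longrightarrow> inf (z m) (z n) = 0"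
    and w: "\<And>v. eventually (\<lambda>n. z n \<le> v) sequentially \<Longrightarrow> w \<le> v"
  shows "w \<le> 0"
proof -
  define D where "D = {v. eventually (\<lambda>n. z n \<le> v) sequentially}"
  define p where "p = sup w 0"
  have u: "u \<in> D" using zu by (simp add: D_def)
  have pos: "0 \<le> v" if "v \<in> D" for v
    using that z0 by (auto simp: D_def eventually_sequentially intro: order_trans)
  have p: "0 \<le> p" "\<And>v. v \<in> D \<Longrightarrow> p \<le> v"
    using w pos by (auto simp: p_def D_def)
  have minus: "v - q \<in> D" if v: "v \<in> D" and q: "q \<le> v" "eventually (\<lambda>n. inf (z n) q = 0) sequentially"
    for v q
  proof -
    have "eventually (\<lambda>n. z n \<le> v) sequentially" using v by (simp add: D_def)
    with q(2) have "eventually (\<lambda>n. z n \<le> v - q) sequentially"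
    proof eventually_elim
      case (elim n)
      from sum_le_of_disjoint[OF elim(1,2) q(1)] show ?case by (simp only: le_diff_eq)
    qed
    then show ?thesis by (simp add: D_def)
  qed
  have pz: "inf p (z k) = 0" for k
  proof (rule le_zero_of_multiples_bounded)
    define q where "q = inf p (z k)"
    have q0: "0 \<le> q" using p(1) z0 by (simp add: q_def)
    have "\<forall>v\<in>D. p + real n *\<^sub>R q \<le> v" for n
    proof (induction n)
      case 0
      show ?case using p by simp
    next
      case (Suc n)
      show ?case
      proof
        fix v assume v: "v \<in> D"
        define r where "r = inf v (z k)"
        have "eventually (\<lambda>n. inf (z n) r = 0) sequentially"
          using eventually_gt_at_top[of k]
        proof eventually_elim
          case (elim n)
          then have "inf (z n) (z k) = 0" by (intro disj) simp
          then show ?case by (rule inf_zero_mono) (use z0 pos[OF v] in \<open>auto simp: r_def\<close>)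
        qed
        then have "v - r \<in> D" using v by (intro minus) (auto simp: r_def)
        then have "p + real n *\<^sub>R q \<le> v - r" using Suc by blast
        moreover have "q \<le> r" using p(2)[OF v] by (auto simp: q_def r_def intro: le_infI1)
        ultimately have "(p + real n *\<^sub>R q) + q \<le> (v - r) + r" by (rule add_mono)
        moreover have "p + real (Suc n) *\<^sub>R q = (p + real n *\<^sub>R q) + q"
          by (simp add: scaleR_left_distrib add_ac)
        ultimately show "p + real (Suc n) *\<^sub>R q \<le> v" by (simp only: diff_add_cancel)
      qed
    qed
    then have "p + real n *\<^sub>R q \<le> u" for n using u by blast
    then show "real n *\<^sub>R inf p (z k) \<le> u" for n
      using p(1) unfolding q_def by (meson le_add_same_cancel2 order_trans)
    show "0 \<le> inf p (z k)" using q0 by (simp add: q_def)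
  qed
  have "\<forall>v\<in>D. real n *\<^sub>R p \<le> v" for n
  proof (induction n)
    case 0
    show ?case using pos by simp
  next
    case (Suc n)
    show ?case
    proof
      fix v assume v: "v \<in> D"
      have "v - p \<in> D" using p(2)[OF v] pz by (intro minus[OF v]) (auto simp: inf_commute)
      then have "real n *\<^sub>R p \<le> v - p" using Suc by blast
      then have "real n *\<^sub>R p + p \<le> v" by (simp only: le_diff_eq)
      moreover have "real (Suc n) *\<^sub>R p = real n *\<^sub>R p + p"
        by (simp add: scaleR_left_distrib add_ac)
      ultimately show "real (Suc n) *\<^sub>R p \<le> v" by simp
    qed
  qed
  then have "real n *\<^sub>R p \<le> u" for n using u by blast
  from le_zero_of_multiples_bounded[OF p(1) this] have "sup w 0 = 0" by (simp add: p_def)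
  then show ?thesis by (metis sup_ge1)
qed

text \<open>
  Transports the order of the natural numbers to the range of an injection \<open>h\<close>. Nets are indexed by
  sets of a prescribed type, and sequences enter as the nets over such a copy of the naturals.
\<close>

definition seq_order :: "(nat \<Rightarrow> 'i) \<Rightarrow> 'i rel" where
  "seq_order h = {(h m, h n) | m n. m \<le> n}"

lemma seq_order_iff: "inj h \<Longrightarrow> (h m, h n) \<in> seq_order h \<longleftrightarrow> m \<le> n"
  by (auto simp: seq_order_def inj_eq)

lemma directed_seq_order:
  assumes h: "inj h"
  shows "directed_set (range h) (seq_order h)"
  unfolding directed_set_def
proof (intro conjI ballI)
  show "preorder_on (range h) (seq_order h)"
    unfolding preorder_on_def
  proof (intro conjI)
    show "seq_order h \<subseteq> range h \<times> range h" by (auto simp: seq_order_def)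
    show "refl_on (range h) (seq_order h)" by (auto simp: refl_on_def seq_order_def)
    show "trans (seq_order h)"
      by (rule transI) (use h in \<open>auto simp: seq_order_def inj_eq intro: order_trans\<close>)
  qed
  fix p q assume "p \<in> range h" "q \<in> range h"
  then obtain m n where "p = h m" "q = h n" by auto
  then show "\<exists>k\<in>range h. (p, k) \<in> seq_order h \<and> (q, k) \<in> seq_order h"
    by (intro bexI[of _ "h (max m n)"]) (auto simp: seq_order_iff[OF h])
qed auto

lemma no_last_seq_order:
  assumes h: "inj h"
  shows "no_last (range h) (seq_order h)"
  unfolding no_last_def
proof
  fix i assume "i \<in> range h"
  then obtain n where "i = h n" by auto
  then show "\<exists>j\<in>range h. (j, i) \<notin> seq_order h"
    by (intro bexI[of _ "h (Suc n)"]) (auto simp: seq_order_iff[OF h])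
qed

lemma eventually_tails_seq_order:
  assumes h: "inj h"
  shows "eventually P (tails (range h) (seq_order h)) \<longleftrightarrow> eventually (\<lambda>n. P (h n)) sequentially"
  by (auto simp: eventually_tails[OF directed_seq_order[OF h]] seq_order_iff[OF h] eventually_sequentially)

lemma tendsto_tails_seq_order:
  assumes h: "inj h"
  shows "(f \<longlongrightarrow> l) (tails (range h) (seq_order h)) \<longleftrightarrow> (\<lambda>n. f (h n)) \<longlonglongrightarrow> l"
  unfolding tendsto_def eventually_tails_seq_order[OF h] by simp

lemma disjoint_seq_uo_null:
  fixes x :: "'i \<Rightarrow> 'e::banach_lattice"
  assumes h: "inj h" and x: "disjoint_net (range h) x"
  shows "uo_null (range h) (seq_order h) x"
  unfolding uo_null_def
proof (intro allI impI)
  fix u :: 'e assume u: "0 \<le> u"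
  define z where "z n = inf \<bar>x (h n)\<bar> u" for n
  define D where "D = {v. eventually (\<lambda>n. z n \<le> v) sequentially}"
  define s where "s = {(v, v'). v \<in> D \<and> v' \<in> D \<and> v' \<le> v}"
  have z: "0 \<le> z n" "z n \<le> u" for n using u by (auto simp: z_def)
  have disj: "inf (z m) (z n) = 0" if "m \<noteq> n" for m n
  proof -
    have "inf \<bar>x (h m)\<bar> \<bar>x (h n)\<bar> = 0"
      using x that h by (auto simp: disjoint_net_def inj_eq)
    then show ?thesis by (rule inf_zero_mono) (use u in \<open>auto simp: z_def\<close>)
  qed
  show "order_conv (range h) (seq_order h) (\<lambda>i. inf \<bar>x i\<bar> u) 0"
  proof (rule order_convI[where B = D and s = s and y = "\<lambda>v. v"])
    show "directed_set D s"
      unfolding directed_set_def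
    proof (intro conjI ballI)
      have "u \<in> D" using z by (simp add: D_def)
      then show "D \<noteq> {}" by blast
      show "preorder_on D s" by (auto simp: preorder_on_def refl_on_def trans_def s_def)
      fix v v' assume v: "v \<in> D" "v' \<in> D"
      then have "eventually (\<lambda>n. z n \<le> inf v v') sequentially"
        by (auto simp: D_def intro: eventually_conj)
      then have "inf v v' \<in> D" by (simp add: D_def)
      then show "\<exists>k\<in>D. (v, k) \<in> s \<and> (v', k) \<in> s"
        using v by (intro bexI[of _ "inf v v'"]) (auto simp: s_def)
    qed
    have pos: "0 \<le> v" if "v \<in> D" for v
      using that z(1) by (auto simp: D_def eventually_sequentially intro: order_trans)
    have "w \<le> 0" if "\<And>v. v \<in> D \<Longrightarrow> w \<le> v" for w
      by (rule tail_bounds_inf_zero[of z u]) (use z disj that in \<open>simp_all add: D_def\<close>)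
    then have "isGlb UNIV ((\<lambda>v. v) ` D) 0"
      using pos by (auto simp: isGlb_def greatestP_def isLb_def setle_def setge_def)
    then show "decreases_to_zero D s (\<lambda>v. v)"
      by (auto simp: decreases_to_zero_def s_def)
    show "\<forall>b\<in>D. \<exists>i0\<in>range h. \<forall>i\<in>range h. (i0, i) \<in> seq_order h \<longrightarrow> \<bar>inf \<bar>x i\<bar> u - 0\<bar> \<le> b"
    proof
      fix b assume "b \<in> D"
      then obtain N where N: "\<And>n. N \<le> n \<Longrightarrow> z n \<le> b"
        by (auto simp: D_def eventually_sequentially)
      have abs_z: "\<bar>inf \<bar>x i\<bar> u - 0\<bar> = inf \<bar>x i\<bar> u" for i
        using u by (simp add: abs_of_nonneg)
      show "\<exists>i0\<in>range h. \<forall>i\<in>range h. (i0, i) \<in> seq_order h \<longrightarrow> \<bar>inf \<bar>x i\<bar> u - 0\<bar> \<le> b"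
        unfolding abs_z using N by (intro bexI[of _ "h N"]) (auto simp: seq_order_iff[OF h] z_def)
    qed
  qed
qed

text \<open>
  The values \<open>\<phi> (z n)\<close> tend to zero because they are even absolutely summable:
  choosing signs, \<open>\<Sum> \<bar>\<phi> (z n)\<bar> = \<phi> (\<Sum> \<plusminus> z n)\<close>, and by disjointness \<open>\<bar>\<Sum> \<plusminus> z n\<bar> \<le> u\<close>.
\<close>

lemma bounded_linear_disjoint_tendsto_zero:
  fixes z :: "nat \<Rightarrow> 'e::banach_lattice" and \<phi> :: "'e \<Rightarrow> real"
  assumes \<phi>: "bounded_linear \<phi>" and z: "\<And>n. 0 \<le> z n" "\<And>n. z n \<le> u"
    and disj: "\<And>m n. m \<noteq> n \<Longrightarrow> inf (z m) (z n) = 0"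
  shows "(\<lambda>n. \<phi> (z n)) \<longlonglongrightarrow> 0"
proof -
  obtain K where K: "0 \<le> K" "\<And>y. norm (\<phi> y) \<le> norm y * K"
    using bounded_linear.nonneg_bounded[OF \<phi>] by blast
  have lin: "linear \<phi>" using \<phi> by (rule bounded_linear.linear)
  have u: "0 \<le> u" by (rule order_trans[OF z])
  have "(\<Sum>n<N. \<bar>\<phi> (z n)\<bar>) \<le> norm u * K" for N
  proof -
    define y where "y = (\<Sum>n<N. sgn (\<phi> (z n)) *\<^sub>R z n)"
    have "\<bar>y\<bar> \<le> (\<Sum>n<N. \<bar>sgn (\<phi> (z n)) *\<^sub>R z n\<bar>)" unfolding y_def by (rule sum_abs)
    also have "\<dots> \<le> (\<Sum>n<N. z n)"
    proof (rule sum_mono)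
      fix n
      have "\<bar>sgn (\<phi> (z n)) *\<^sub>R z n\<bar> \<le> \<bar>sgn (\<phi> (z n))\<bar> *\<^sub>R \<bar>z n\<bar>" by (rule abs_scaleR_le)
      also have "\<dots> \<le> 1 *\<^sub>R \<bar>z n\<bar>" by (rule scaleR_right_mono) (auto simp: sgn_real_def)
      finally show "\<bar>sgn (\<phi> (z n)) *\<^sub>R z n\<bar> \<le> z n" using z(1) by (simp add: abs_of_nonneg)
    qed
    also have "\<dots> \<le> u" by (rule disjoint_sum_le) (use z disj u in simp_all)
    finally have "norm y \<le> norm u" using u by (intro norm_abs_mono) (simp add: abs_of_nonneg)
    have "(\<Sum>n<N. \<bar>\<phi> (z n)\<bar>) = \<phi> y"
      by (simp add: y_def linear_sum[OF lin] linear_scale[OF lin] abs_sgn mult.commute)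
    also have "\<dots> \<le> norm y * K" using K(2)[of y] by simp
    also have "\<dots> \<le> norm u * K" using \<open>norm y \<le> norm u\<close> K(1) by (rule mult_right_mono)
    finally show ?thesis .
  qed
  then have "summable (\<lambda>n. \<bar>\<phi> (z n)\<bar>)"
    by (intro summableI_nonneg_bounded[where x = "norm u * K"]) auto
  then show ?thesis by (rule summable_LIMSEQ_zero[OF summable_rabs_cancel])
qed

lemma disjoint_seq_bounded_linear:
  fixes x :: "'i \<Rightarrow> 'e::banach_lattice" and \<phi> :: "'e \<Rightarrow> real"
  assumes h: "inj h" and x: "disjoint_net (range h) x" and u: "0 \<le> u" and \<phi>: "bounded_linear \<phi>"
  shows "((\<lambda>i. \<phi> (inf \<bar>x i\<bar> u)) \<longlongrightarrow> 0) (tails (range h) (seq_order h))"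
  unfolding tendsto_tails_seq_order[OF h]
proof (rule bounded_linear_disjoint_tendsto_zero[OF \<phi>, where u = u])
  show "inf (inf \<bar>x (h m)\<bar> u) (inf \<bar>x (h n)\<bar> u) = 0" if "m \<noteq> n" for m n
  proof -
    have "inf \<bar>x (h m)\<bar> \<bar>x (h n)\<bar> = 0"
      using x that h by (auto simp: disjoint_net_def inj_eq)
    then show ?thesis by (rule inf_zero_mono) (use u in auto)
  qed
qed (use u in auto)

lemma disjoint_seq_uaw_null:
  assumes "inj h" "disjoint_net (range h) x"
  shows "uaw_null (range h) (seq_order h) x"
  unfolding uaw_null_def
  by (intro allI impI disjoint_seq_bounded_linear[OF assms] blinfun.bounded_linear_right)

text \<open>Evaluation at a point of the predual is a bounded functional, so weak* convergence follows from weak.\<close>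

lemma disjoint_seq_uaw_star_null:
  fixes J :: "'e::banach_lattice \<Rightarrow> ('g::banach_lattice \<Rightarrow>\<^sub>L real)"
  assumes "inj h" "disjoint_net (range h) x" and J: "dual_representation J"
  shows "uaw_star_null J (range h) (seq_order h) x"
  unfolding uaw_star_null_def
proof (intro allI impI)
  fix u :: 'e and g :: 'g assume u: "0 \<le> u"
  have lin: "linear J" and iso: "\<And>y. norm (J y) = norm y" using J by (auto simp: dual_representation_def)
  have "bounded_linear (\<lambda>y. blinfun_apply (J y) g)"
  proof (rule bounded_linear_intro[where K = "norm g"])
    show "norm (blinfun_apply (J y) g) \<le> norm y * norm g" for y
      using norm_blinfun[of "J y" g] by (simp add: iso)
  qed (simp_all add: linear_add[OF lin] linear_scale[OF lin] blinfun.add_left blinfun.scaleR_left)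
  from disjoint_seq_bounded_linear[OF assms(1,2) u this]
  show "((\<lambda>i. blinfun_apply (J (inf \<bar>x i\<bar> u)) g) \<longlongrightarrow> 0) (tails (range h) (seq_order h))" .
qed

lemma order_conv_zero_norm:
  fixes x :: "'i \<Rightarrow> 'e::banach_lattice"
  assumes oc: "order_continuous_norm TYPE('e)" and dir: "directed_set I r" and x: "order_conv I r x 0"
  shows "(x \<longlongrightarrow> 0) (tails I r)"
proof (rule tendstoI)
  fix \<epsilon> :: real assume "0 < \<epsilon>"
  obtain B :: "'e idx set" and s y where B: "directed_set B s" "decreases_to_zero B s y"
    and dom: "\<And>b. b \<in> B \<Longrightarrow> \<exists>i0\<in>I. \<forall>i\<in>I. (i0, i) \<in> r \<longrightarrow> \<bar>x i - 0\<bar> \<le> y b"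
    using x unfolding order_conv_def by blast
  have "((\<lambda>b. norm (y b)) \<longlongrightarrow> 0) (tails B s)"
    using oc B unfolding order_continuous_norm_def by blast
  from tendstoD[OF this \<open>0 < \<epsilon>\<close>] obtain b where b: "b \<in> B" "\<And>c. c \<in> B \<Longrightarrow> (b, c) \<in> s \<Longrightarrow> norm (y c) < \<epsilon>"
    by (auto simp: eventually_tails[OF B(1)])
  have "(b, b) \<in> s" using B(1) b(1) by (auto simp: directed_set_def preorder_on_def refl_on_def)
  then have nb: "norm (y b) < \<epsilon>" using b by blast
  obtain i0 where i0: "i0 \<in> I" "\<And>i. i \<in> I \<Longrightarrow> (i0, i) \<in> r \<Longrightarrow> \<bar>x i\<bar> \<le> y b"
    using dom[OF b(1)] by auto
  have "dist (x i) 0 < \<epsilon>" if "i \<in> I" "(i0, i) \<in> r" for i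
    using norm_le_of_nonneg_le[OF abs_ge_zero i0(2)[OF that]] nb by (simp add: norm_abs_eq)
  then show "eventually (\<lambda>i. dist (x i) 0 < \<epsilon>) (tails I r)"
    using i0(1) by (auto simp: eventually_tails[OF dir])
qed

lemma uo_null_imp_un_null:
  fixes x :: "'i \<Rightarrow> 'e::banach_lattice"
  assumes "order_continuous_norm TYPE('e)" "directed_set I r" "uo_null I r x"
  shows "un_null I r x"
  unfolding un_null_def
proof (intro allI impI)
  fix u :: 'e assume "0 \<le> u"
  then have "order_conv I r (\<lambda>i. inf \<bar>x i\<bar> u) 0" using assms(3) by (simp add: uo_null_def)
  then show "((\<lambda>i. inf \<bar>x i\<bar> u) \<longlongrightarrow> 0) (tails I r)" by (rule order_conv_zero_norm[OF assms(1,2)])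
qed


section \<open>The carrier\<close>

text \<open>
  Infinitely many normalised atoms \<open>e\<^sub>n\<close> outside the kernel of \<open>T\<close> can be rescaled to a disjoint
  sequence \<open>x\<^sub>n\<close> with \<open>\<parallel>T x\<^sub>n\<parallel> = 1\<close>. This contradicts the continuity of \<open>T\<close> along disjoint
  sequences, which is what all five conditions of the theorem have in common.
\<close>

lemma unit_atoms_outside_kernel_finite:
  fixes T :: "'e::banach_lattice \<Rightarrow> 'f::banach_lattice"
  assumes T: "linear T"
    and seq: "\<And>(h :: nat \<Rightarrow> 'e idx) x. inj h \<Longrightarrow> disjoint_net (range h) x \<Longrightarrow>
      ((\<lambda>i. T (x i)) \<longlongrightarrow> 0) (tails (range h) (seq_order h))"
  shows "finite {e. atom e \<and> norm e = 1 \<and> T e \<noteq> 0}"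
proof (rule ccontr)
  assume "\<not> ?thesis"
  then obtain e :: "nat \<Rightarrow> 'e" where e: "inj e" "range e \<subseteq> {e. atom e \<and> norm e = 1 \<and> T e \<noteq> 0}"
    using infinite_countable_subset by blast
  have at: "atom (e n)" "norm (e n) = 1" "T (e n) \<noteq> 0" for n using e(2) by auto
  \<comment> \<open>The second component is a dummy that pads atoms to elements of the index type.\<close>
  define h :: "nat \<Rightarrow> 'e idx" where "h n = (e n, {})" for n
  define x :: "'e idx \<Rightarrow> 'e" where "x i = inverse (norm (T (fst i))) *\<^sub>R fst i" for i
  have h: "inj h" using e(1) by (auto simp: h_def inj_def)
  have "disjoint_net (range h) x"
    unfolding disjoint_net_def
  proof (intro ballI impI)
    fix i j assume "i \<in> range h" "j \<in> range h" "i \<noteq> j"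
    then obtain m n where ij: "i = h m" "j = h n" "m \<noteq> n" by auto
    have nn: "0 \<le> e k" for k using atom_pos[OF at(1)] by (rule less_imp_le)
    have c: "0 \<le> inverse (norm (T (e k)))" for k by simp
    have "e m \<noteq> e n" using ij(3) e(1) by (simp add: inj_eq)
    then have "inf (e m) (e n) = 0" by (intro unit_atoms_disjoint at)
    then have "inf (inverse (norm (T (e m))) *\<^sub>R e m) (e n) = 0"
      by (intro inf_scale_zero nn c)
    then have "inf (inverse (norm (T (e n))) *\<^sub>R e n) (inverse (norm (T (e m))) *\<^sub>R e m) = 0"
      by (intro inf_scale_zero nn c scaleR_nonneg_nonneg) (simp add: inf_commute)
    moreover have "\<bar>x (h k)\<bar> = inverse (norm (T (e k))) *\<^sub>R e k" for k
      using nn c by (simp add: x_def h_def abs_of_nonneg scaleR_nonneg_nonneg)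
    ultimately show "inf \<bar>x i\<bar> \<bar>x j\<bar> = 0" by (simp add: ij inf_commute)
  qed
  from seq[OF h this] have "(\<lambda>n. T (x (h n))) \<longlonglongrightarrow> 0" by (simp add: tendsto_tails_seq_order[OF h])
  then have "(\<lambda>n. norm (T (x (h n)))) \<longlonglongrightarrow> 0" by (rule tendsto_norm_zero)
  moreover have "norm (T (x (h n))) = 1" for n
    using at(3)[of n] by (simp add: x_def h_def linear_scale[OF T])
  ultimately show False by (simp add: LIMSEQ_const_iff)
qed

text \<open>
  An atom with \<open>T e \<noteq> 0\<close> meets the null ideal of the modulus only in \<open>0\<close>: a nonzero common part with
  a null vector would contain a positive multiple of \<open>e\<close>, making \<open>e\<close> itself null.
\<close>

lemma atom_in_carrier:
  fixes T :: "'e::banach_lattice \<Rightarrow> 'f::banach_lattice"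
  assumes M: "is_modulus T M" and e: "atom e" and Te: "T e \<noteq> 0"
  shows "e \<in> carrier_of T"
  unfolding carrier_of_def op_modulus_eq[OF M] disj_compl_def
proof safe
  fix y assume y: "M \<bar>y\<bar> = 0"
  have lM: "linear M" using M by (simp add: is_modulus_def)
  have e0: "0 \<le> e" using atom_pos[OF e] by (rule less_imp_le)
  have "inf \<bar>y\<bar> e = 0"
  proof (rule atom_disjoint_of_no_multiple[OF e])
    fix \<delta> :: real assume \<delta>: "0 < \<delta>"
    show "\<not> \<delta> *\<^sub>R e \<le> \<bar>y\<bar>"
    proof
      assume "\<delta> *\<^sub>R e \<le> \<bar>y\<bar>"
      then have "0 \<le> M (\<bar>y\<bar> - \<delta> *\<^sub>R e)" by (intro modulus_nonneg[OF M]) (simp only: diff_ge_0_iff_ge)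
      then have "\<delta> *\<^sub>R M e \<le> 0" using y by (simp add: linear_diff[OF lM] linear_scale[OF lM])
      then have "inverse \<delta> *\<^sub>R (\<delta> *\<^sub>R M e) \<le> inverse \<delta> *\<^sub>R 0" using \<delta> by (intro scaleR_left_mono) auto
      then have "M e \<le> 0" using \<delta> by simp
      then have "\<bar>T e\<bar> \<le> 0" using abs_leI[OF modulus_dominates[OF M e0]] by (rule order_trans[rotated])
      then show False using Te by simp
    qed
  qed simp
  then show "inf \<bar>e\<bar> \<bar>y\<bar> = 0" by (simp add: atom_abs[OF e] inf_commute)
qed

text \<open>
  For \<open>x\<close> in the carrier, subtracting from \<open>\<bar>x\<bar>\<close> its components along the finitely many atoms of \<open>A\<close>
  leaves a vector disjoint from those atoms. It is still in the carrier, hence disjoint from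
  the remaining atoms, on which the modulus vanishes. So nothing is left.
\<close>

lemma carrier_eq_band_hull:
  fixes T :: "'e::banach_lattice \<Rightarrow> 'f::banach_lattice"
  assumes at: "atomic_lattice TYPE('e)" and T: "linear T" and M: "is_modulus T M"
    and A_def: "A = {e. atom e \<and> norm e = 1 \<and> T e \<noteq> 0}" and fin: "finite A"
  shows "carrier_of T = band hull A"
proof
  show "band hull A \<subseteq> carrier_of T"
  proof (rule hull_minimal)
    show "A \<subseteq> carrier_of T" using atom_in_carrier[OF M] by (auto simp: A_def)
    show "band (carrier_of T)" unfolding carrier_of_def by (rule band_disj_compl)
  qed
next
  show "carrier_of T \<subseteq> band hull A"
  proof
    fix x assume x: "x \<in> carrier_of T"
    have A: "atom e" "norm e = 1" "0 \<le> e" if "e \<in> A" for e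
      using that atom_pos[of e] by (auto simp: A_def)
    define f where "f e = atom_coeff e \<bar>x\<bar> *\<^sub>R e" for e
    define y where "y = \<bar>x\<bar> - sum f A"
    have f0: "0 \<le> f e" and fx: "f e \<le> \<bar>x\<bar>" if "e \<in> A" for e
      using atom_coeff_nonneg[OF A(1)[OF that] abs_ge_zero] A(3)[OF that]
      by (auto simp: f_def scaleR_nonneg_nonneg)
    have f_compl: "f a \<in> disj_compl {e}" if "a \<in> A" "e \<in> A" "a \<noteq> e" for a e
    proof -
      have "inf a e = 0" using that A by (intro unit_atoms_disjoint) auto
      then have "a \<in> disj_compl {e}" using that A by (simp add: disj_compl_def atom_abs)
      then show ?thesis unfolding f_def by (rule subspace_scale[OF subspace_disj_compl])
    qed
    have "sum f A \<le> \<bar>x\<bar>"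
    proof (rule disjoint_sum_le[OF fin f0 fx abs_ge_zero])
      fix a e assume ae: "a \<in> A" "e \<in> A" "a \<noteq> e"
      have "inf (f a) e = 0"
        using f_compl[OF ae] f0[OF ae(1)] A(3)[OF ae(2)] by (simp add: disj_compl_def abs_of_nonneg)
      then have "inf (f e) (f a) = 0"
        unfolding f_def[of e] using f0[OF ae(1)] A[OF ae(2)] atom_coeff_nonneg(1)[OF A(1)[OF ae(2)]]
        by (intro inf_scale_zero) (auto simp: inf_commute)
      then show "inf (f a) (f e) = 0" by (simp add: inf_commute)
    qed
    then have y0: "0 \<le> y" by (simp add: y_def)
    have "y \<le> \<bar>x\<bar>" using sum_nonneg[of A f, OF f0] by (simp add: y_def)
    then have yC: "y \<in> carrier_of T"
      using x y0 unfolding carrier_of_def by (auto intro: disj_compl_solid simp: abs_of_nonneg)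
    have yA: "y \<in> disj_compl {e}" if "e \<in> A" for e
    proof -
      have "sum f A = f e + sum f (A - {e})" using fin that by (rule sum.remove)
      then have "y = (\<bar>x\<bar> - f e) - sum f (A - {e})" by (simp add: y_def)
      moreover have "sum f (A - {e}) \<in> disj_compl {e}"
        using f_compl that by (intro subspace_sum[OF subspace_disj_compl]) auto
      moreover have "\<bar>x\<bar> - f e \<in> disj_compl {e}"
        unfolding f_def by (rule atom_coeff_decomp[OF A(1)[OF that]])
      ultimately show ?thesis by (simp only: subspace_diff[OF subspace_disj_compl])
    qed
    have "y = 0"
    proof (rule disjoint_from_atoms_zero[OF at])
      fix e :: 'e assume e: "atom e"
      show "inf \<bar>y\<bar> \<bar>e\<bar> = 0"
      proof (cases "T e = 0")
        case True
        have "0 \<le> e" using atom_pos[OF e] by (rule less_imp_le)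
        then have "M e = 0"
          using modulus_atom_le[OF M T e] modulus_nonneg[OF M] True by (auto intro: antisym)
        then have "M \<bar>e\<bar> = 0" using atom_abs[OF e] by simp
        then show ?thesis
          using yC by (simp add: carrier_of_def op_modulus_eq[OF M] disj_compl_def)
      next
        case False
        define e' where "e' = inverse (norm e) *\<^sub>R e"
        have ne: "0 < norm e" using atom_pos[OF e] by auto
        have "atom e'" unfolding e'_def using e ne by (intro atom_scale) auto
        moreover have "norm e' = 1" using ne by (simp add: e'_def)
        moreover have "T e' \<noteq> 0" using False ne by (simp add: e'_def linear_scale[OF T])
        ultimately have "y \<in> disj_compl {e'}" by (intro yA) (simp add: A_def)
        then have "e' \<in> disj_compl {y}" by (simp add: disj_compl_def inf_commute)
        then have "norm e *\<^sub>R e' \<in> disj_compl {y}" by (rule subspace_scale[OF subspace_disj_compl])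
        then have "e \<in> disj_compl {y}" using ne by (simp add: e'_def)
        then show ?thesis by (simp add: disj_compl_def inf_commute)
      qed
    qed
    then have "\<bar>x\<bar> = sum f A" by (simp add: y_def)
    show "x \<in> band hull A"
      unfolding hull_def
    proof safe
      fix B assume B: "A \<subseteq> B" "band B"
      then have sub: "subspace B" and solid: "\<And>x y. y \<in> B \<Longrightarrow> \<bar>x\<bar> \<le> \<bar>y\<bar> \<Longrightarrow> x \<in> B"
        by (auto simp: band_def)
      have "f e \<in> B" if "e \<in> A" for e
        unfolding f_def using that B(1) by (intro subspace_scale[OF sub]) blast
      then have "sum f A \<in> B" by (rule subspace_sum[OF sub])
      then have "\<bar>x\<bar> \<in> B" using \<open>\<bar>x\<bar> = sum f A\<close> by (simp only:)
      then show "x \<in> B" by (rule solid) simp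
    qed
  qed
qed

theorem theorem2p2:
  fixes T :: "'e::banach_lattice \<Rightarrow> 'f::banach_lattice"
  assumes "atomic_lattice TYPE('e)"
    and "linear T" and "T \<noteq> (\<lambda>_. 0)" and "has_modulus T"
    and "(\<forall>(I :: 'e idx set) r x. directed_set I r \<and> no_last I r \<and> disjoint_net I x \<longrightarrow>
            ((\<lambda>i. T (x i)) \<longlongrightarrow> 0) (tails I r))
       \<or> (\<forall>(I :: 'e idx set) r x. directed_set I r \<and> uo_null I r x \<longrightarrow>
            ((\<lambda>i. T (x i)) \<longlongrightarrow> 0) (tails I r))
       \<or> (order_continuous_norm TYPE('e) \<and>
          (\<forall>(I :: 'e idx set) r x. directed_set I r \<and> un_null I r x \<longrightarrow>
            ((\<lambda>i. T (x i)) \<longlongrightarrow> 0) (tails I r)))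
       \<or> (\<forall>(I :: 'e idx set) r x. directed_set I r \<and> uaw_null I r x \<longrightarrow>
            ((\<lambda>i. T (x i)) \<longlongrightarrow> 0) (tails I r))
       \<or> (\<exists>J :: 'e \<Rightarrow> ('g::banach_lattice \<Rightarrow>\<^sub>L real). dual_representation J \<and>
          (\<forall>(I :: 'e idx set) r x. directed_set I r \<and> uaw_star_null J I r x \<longrightarrow>
            ((\<lambda>i. T (x i)) \<longlongrightarrow> 0) (tails I r)))"
  shows "\<exists>A. finite A \<and> (\<forall>e\<in>A. atom e) \<and> carrier_of T = band hull A"
proof -
  obtain M where M: "is_modulus T M" using assms(4) by (auto simp: has_modulus_def)
  have seq: "((\<lambda>i. T (x i)) \<longlongrightarrow> 0) (tails (range h) (seq_order h))"
    if h: "inj h" and x: "disjoint_net (range h) x" for h :: "nat \<Rightarrow> 'e idx" and x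
    using assms(5)
  proof (elim disjE conjE exE)
    assume "\<forall>(I :: 'e idx set) r x. directed_set I r \<and> no_last I r \<and> disjoint_net I x \<longrightarrow>
      ((\<lambda>i. T (x i)) \<longlongrightarrow> 0) (tails I r)"
    then show ?thesis using directed_seq_order[OF h] no_last_seq_order[OF h] x by blast
  next
    assume "\<forall>(I :: 'e idx set) r x. directed_set I r \<and> uo_null I r x \<longrightarrow>
      ((\<lambda>i. T (x i)) \<longlongrightarrow> 0) (tails I r)"
    then show ?thesis using directed_seq_order[OF h] disjoint_seq_uo_null[OF h x] by blast
  next
    assume oc: "order_continuous_norm TYPE('e)"
      and un: "\<forall>(I :: 'e idx set) r x. directed_set I r \<and> un_null I r x \<longrightarrow>
        ((\<lambda>i. T (x i)) \<longlongrightarrow> 0) (tails I r)"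
    have "un_null (range h) (seq_order h) x"
      using oc directed_seq_order[OF h] disjoint_seq_uo_null[OF h x] by (rule uo_null_imp_un_null)
    then show ?thesis using un directed_seq_order[OF h] by blast
  next
    assume "\<forall>(I :: 'e idx set) r x. directed_set I r \<and> uaw_null I r x \<longrightarrow>
      ((\<lambda>i. T (x i)) \<longlongrightarrow> 0) (tails I r)"
    then show ?thesis using directed_seq_order[OF h] disjoint_seq_uaw_null[OF h x] by blast
  next
    fix J :: "'e \<Rightarrow> ('g \<Rightarrow>\<^sub>L real)"
    assume J: "dual_representation J"
      and uaw: "\<forall>(I :: 'e idx set) r x. directed_set I r \<and> uaw_star_null J I r x \<longrightarrow>
        ((\<lambda>i. T (x i)) \<longlongrightarrow> 0) (tails I r)"
    show ?thesis using uaw directed_seq_order[OF h] disjoint_seq_uaw_star_null[OF h x J] by blast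
  qed
  define A where "A = {e. atom e \<and> norm e = 1 \<and> T e \<noteq> 0}"
  have fin: "finite A"
    unfolding A_def using assms(2) seq by (rule unit_atoms_outside_kernel_finite)
  have "carrier_of T = band hull A"
    using assms(1,2) M A_def fin by (rule carrier_eq_band_hull)
  then show ?thesis using fin by (intro exI[of _ A]) (simp add: A_def)
qed

end
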